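(* Let $\mathbb{T}$ be a time scale, $a,b\in\mathbb{T}$ with $a<b$, $c,d\in\mathbb{R}$, $\alpha\in(0,1]$, $g\in C([a,b]\cap\mathbb{T};(c,d))$ and $h\in C([a,b]\cap\mathbb{T};\mathbb{R})$ with $$\int_a^b|h(s)|\,\Delta^\alpha s>0.$$ (1) If $f\in C((c,d);\mathbb{R})$ is convex, then $$f\left(\frac{\int_a^b g(s)|h(s)|\,\Delta^\alpha s}{\int_a^b|h(s)|\,\Delta^\alpha s}\right)\le\frac{\int_a^b f(g(s))|h(s)|\,\Delta^\alpha s}{\int_a^b|h(s)|\,\Delta^\alpha s}.$$ (2) If $f\in C((c,d);\mathbb{R})$ is concave, then $$f\left(\frac{\int_a^b g(s)|h(s)|\,\Delta^\alpha s}{\int_a^b|h(s)|\,\Delta^\alpha s}\right)\ge\frac{\int_a^b f(g(s))|h(s)|\,\Delta^\alpha s}{\int_a^b|h(s)|\,\Delta^\alpha s}.$$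
   Context: A time scale $\mathbb{T}$ is a nonempty closed subset of $\mathbb{R}$. $C(X;Y)$ denotes the continuous functions from $X$ to $Y$. The $\alpha$-fractional integral of a function $f$ is $\int f(t)\,\Delta^\alpha t:=\int f(t)\,t^{\alpha-1}\,\Delta t$, where the right-hand side is the usual (indefinite) Hilger delta-integral on $\mathbb{T}$. Writing $F_\alpha(t)=\int f(t)\,\Delta^\alpha t$, the Cauchy $\alpha$-fractional integral is $\int_a^b f(t)\,\Delta^\alpha t:=F_\alpha(b)-F_\alpha(a)$ for $a,b\in\mathbb{T}$. *)

theory Defs
  imports "HOL-Analysis.Analysis"
begin

definition time_scale :: "real set \<Rightarrow> bool" where
  "time_scale T \<longleftrightarrow> T \<noteq> {} \<and> closed T"

text \<open>The jump operators, with the usual conventions that \<open>inf {} = sup T\<close> for the forward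
  and \<open>sup {} = inf T\<close> for the backward operator, so a maximum (minimum) of \<open>T\<close> is a fixed
  point of the forward (backward) jump.\<close>

definition forward_jump :: "real set \<Rightarrow> real \<Rightarrow> real" where
  "forward_jump T t = (if \<exists>s\<in>T. t < s then Inf {s\<in>T. t < s} else t)"

definition backward_jump :: "real set \<Rightarrow> real \<Rightarrow> real" where
  "backward_jump T t = (if \<exists>s\<in>T. s < t then Sup {s\<in>T. s < t} else t)"

text \<open>\<open>T\<close> without its left-scattered maximum, if it has one.\<close>

definition ts_kappa :: "real set \<Rightarrow> real set" where
  "ts_kappa T = {t\<in>T. \<not> ((\<forall>s\<in>T. s \<le> t) \<and> backward_jump T t < t)}"

text \<open>\<open>D\<close> is the Hilger (delta) derivative of \<open>F\<close> at \<open>t\<close>.\<close>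

definition has_delta_derivative ::
    "(real \<Rightarrow> real) \<Rightarrow> real \<Rightarrow> real set \<Rightarrow> real \<Rightarrow> bool" where
  "has_delta_derivative F D T t \<longleftrightarrow>
     (\<forall>e>0. \<exists>d>0. \<forall>s\<in>T. \<bar>s - t\<bar> < d \<longrightarrow>
        \<bar>F (forward_jump T t) - F s - D * (forward_jump T t - s)\<bar> \<le> e * \<bar>forward_jump T t - s\<bar>)"

text \<open>\<open>F\<close> is a pre-antiderivative of \<open>f\<close>: it is continuous and differentiable with derivative
  \<open>f\<close> on a region \<open>D\<close>, where only countably many points, none of them right-scattered, are
  left out. This is the notion that defines the indefinite delta integral.\<close>

definition delta_pre_antiderivative ::
    "real set \<Rightarrow> (real \<Rightarrow> real) \<Rightarrow> (real \<Rightarrow> real) \<Rightarrow> bool" where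
  "delta_pre_antiderivative T f F \<longleftrightarrow>
     continuous_on T F \<and>
     (\<exists>D \<subseteq> ts_kappa T.
        countable (ts_kappa T - D) \<and>
        (\<forall>t \<in> ts_kappa T - D. \<not> t < forward_jump T t) \<and>
        (\<forall>t \<in> D. has_delta_derivative F (f t) T t))"

definition delta_integrable :: "real set \<Rightarrow> (real \<Rightarrow> real) \<Rightarrow> bool" where
  "delta_integrable T f \<longleftrightarrow> (\<exists>F. delta_pre_antiderivative T f F)"

text \<open>The indefinite integral is determined only up to an additive constant; the choice is
  immaterial for the differences taken below.\<close>

definition indefinite_delta_integral :: "real set \<Rightarrow> (real \<Rightarrow> real) \<Rightarrow> real \<Rightarrow> real" where
  "indefinite_delta_integral T f = (SOME F. delta_pre_antiderivative T f F)"

text \<open>The factor \<open>t\<close> to the power \<open>\<alpha> - 1\<close>. The case \<open>\<alpha> = 1\<close> is separate because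
  \<open>0 powr 0 = 0\<close>, whereas the \<open>1\<close>-fractional integral is the plain delta integral also when
  \<open>0 \<in> T\<close>. For \<open>\<alpha> < 1\<close> the power is meaningful only for \<open>t > 0\<close>; elsewhere the value
  is whatever \<open>powr\<close> assigns.\<close>

definition frac_weight :: "real \<Rightarrow> real \<Rightarrow> real" where
  "frac_weight \<alpha> t = (if \<alpha> = 1 then 1 else t powr (\<alpha> - 1))"

definition frac_integrable :: "real set \<Rightarrow> real \<Rightarrow> (real \<Rightarrow> real) \<Rightarrow> bool" where
  "frac_integrable T \<alpha> f \<longleftrightarrow> delta_integrable T (\<lambda>t. f t * frac_weight \<alpha> t)"

definition indefinite_frac_integral ::
    "real set \<Rightarrow> real \<Rightarrow> (real \<Rightarrow> real) \<Rightarrow> real \<Rightarrow> real" where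
  "indefinite_frac_integral T \<alpha> f = indefinite_delta_integral T (\<lambda>t. f t * frac_weight \<alpha> t)"

text \<open>The Cauchy \<open>\<alpha>\<close>-fractional integral from \<open>a\<close> to \<open>b\<close>, for \<open>a, b \<in> T\<close>. As for the
  integrals of the library, its value is \<open>0\<close> if the integral does not exist.\<close>

definition frac_integral ::
    "real set \<Rightarrow> real \<Rightarrow> real \<Rightarrow> real \<Rightarrow> (real \<Rightarrow> real) \<Rightarrow> real" where
  "frac_integral T \<alpha> a b f =
     (if frac_integrable T \<alpha> f
      then indefinite_frac_integral T \<alpha> f b - indefinite_frac_integral T \<alpha> f a
      else 0)"

end

theory Submission
  imports Defs
begin

text \<open>
  The integral of \<open>\<bar>h\<bar>\<close> is assumed to be positive, hence to exist, but the integrals of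
  \<open>g * \<bar>h\<bar>\<close> and \<open>(f \<circ> g) * \<bar>h\<bar>\<close> must be shown to exist. Continuity alone does not give this:
  for \<open>\<alpha> < 1\<close> the weight \<open>t powr (\<alpha> - 1)\<close> is unbounded near a point \<open>0\<close> of the time scale.
  They exist because they are dominated by the integral of \<open>\<bar>h\<bar>\<close>, and the proof makes this
  domination explicit by a change of variables.

  Let \<open>S = {a..b} \<inter> T\<close> and let \<open>F\<close> be an antiderivative of \<open>\<bar>h\<bar>\<close> times the weight. This
  integrand is nonnegative, so \<open>F\<close> is increasing
  (\<open>mono_on_of_delta_derivative_nonneg\<close>), and \<open>F\<close> measures mass on \<open>S\<close>. Let \<open>q\<close> be the
  quantile function of this mass, which takes a mass \<open>y\<close> to the last point of \<open>S\<close> where \<open>F\<close>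
  is at most \<open>y\<close>. For continuous \<open>k\<close>, the function
  \<open>t \<mapsto> integral {F a..F t} (k \<circ> q)\<close>, an ordinary integral of a bounded Borel function, is an
  antiderivative of \<open>k\<close> times the integrand of \<open>F\<close>
  (\<open>delta_pre_antiderivative_integral_against\<close>). It is the Stieltjes integral of \<open>k\<close> against
  \<open>F\<close>: over a gap of \<open>S\<close> the quantile stays at the left end of the gap, which is where the
  delta integral evaluates its integrand.

  Antiderivatives on \<open>S\<close> differ by a constant, so all three fractional integrals become
  integrals over the interval \<open>{F a..F b}\<close> (\<open>frac_integral_eq_quantile_integral\<close>), whose
  length is the integral of \<open>\<bar>h\<bar>\<close>. What remains is the ordinary Jensen inequality for
  \<open>g \<circ> q\<close> and the uniform distribution on that interval. The concave case follows by passing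
  to \<open>- f\<close>.
\<close>

section \<open>The forward jump and the delta derivative\<close>

lemma forward_jump_between:
  assumes "closed T" "s \<in> T" "t < s"
  shows "forward_jump T t \<in> T" "t \<le> forward_jump T t" "forward_jump T t \<le> s"
proof -
  let ?U = "{s\<in>T. t < s}"
  have ne: "?U \<noteq> {}" and bdd: "bdd_below ?U"
    using assms by (auto intro: bdd_belowI[of _ t])
  have eq: "forward_jump T t = Inf ?U"
    using assms by (auto simp: forward_jump_def)
  show "forward_jump T t \<in> T"
    using closure_contains_Inf[OF ne bdd] closure_mono[of ?U T] assms(1) eq by auto
  show "t \<le> forward_jump T t"
    unfolding eq by (rule cInf_greatest[OF ne]) auto
  show "forward_jump T t \<le> s"
    unfolding eq using assms by (intro cInf_lower[OF _ bdd]) auto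
qed

lemma forward_jump_ge: "closed T \<Longrightarrow> t \<le> forward_jump T t"
  using forward_jump_between(2)[of T _ t] by (cases "\<exists>s\<in>T. t < s") (auto simp: forward_jump_def)

lemma forward_jump_in: "closed T \<Longrightarrow> t \<in> T \<Longrightarrow> forward_jump T t \<in> T"
  using forward_jump_between(1)[of T _ t] by (cases "\<exists>s\<in>T. t < s") (auto simp: forward_jump_def)

lemma right_dense_approach:
  assumes "closed T" "forward_jump T t = t" "s \<in> T" "t < s" "0 < e"
  obtains r where "r \<in> T" "t < r" "r < t + e" "r < s"
proof -
  let ?U = "{s\<in>T. t < s}"
  have "Inf ?U < min (t + e) s"
    using assms by (auto simp: forward_jump_def split: if_splits)
  moreover have "?U \<noteq> {}" using assms by auto
  ultimately show ?thesis
    using cInf_lessD[of ?U "min (t + e) s"] that by auto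
qed

text \<open>The point \<open>t\<close> itself is an admissible comparison point in the delta derivative, which
  forces the exact increment across the gap from \<open>t\<close> to its forward jump.\<close>

lemma has_delta_derivative_jump:
  assumes "has_delta_derivative F D T t" "t \<in> T"
  shows "F (forward_jump T t) - F t = D * (forward_jump T t - t)"
proof -
  let ?j = "forward_jump T t"
  have le: "\<bar>F ?j - F t - D * (?j - t)\<bar> \<le> e * \<bar>?j - t\<bar>" if "e > 0" for e
    using assms that unfolding has_delta_derivative_def
    by (metis abs_zero diff_self)
  have "\<bar>F ?j - F t - D * (?j - t)\<bar> \<le> 0 + e" if "e > 0" for e
  proof -
    have "e / (\<bar>?j - t\<bar> + 1) * \<bar>?j - t\<bar> \<le> e"
      using that by (simp add: field_simps)
    with le[of "e / (\<bar>?j - t\<bar> + 1)"] that show ?thesis by simp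
  qed
  from field_le_epsilon[OF this] show ?thesis by simp
qed

lemma has_delta_derivative_diff:
  assumes "has_delta_derivative F D T t" "has_delta_derivative G E T t"
  shows "has_delta_derivative (\<lambda>x. F x - G x) (D - E) T t"
  unfolding has_delta_derivative_def
proof (intro allI impI)
  fix e :: real assume "e > 0"
  then have "e / 2 > 0" by simp
  let ?j = "forward_jump T t"
  obtain p q where "p > 0" "q > 0"
    and p: "\<And>s. s \<in> T \<Longrightarrow> \<bar>s - t\<bar> < p \<Longrightarrow> \<bar>F ?j - F s - D * (?j - s)\<bar> \<le> e / 2 * \<bar>?j - s\<bar>"
    and q: "\<And>s. s \<in> T \<Longrightarrow> \<bar>s - t\<bar> < q \<Longrightarrow> \<bar>G ?j - G s - E * (?j - s)\<bar> \<le> e / 2 * \<bar>?j - s\<bar>"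
    using assms \<open>e / 2 > 0\<close> unfolding has_delta_derivative_def by metis
  show "\<exists>d>0. \<forall>s\<in>T. \<bar>s - t\<bar> < d \<longrightarrow>
    \<bar>(F ?j - G ?j) - (F s - G s) - (D - E) * (?j - s)\<bar> \<le> e * \<bar>?j - s\<bar>"
  proof (intro exI[of _ "min p q"] conjI ballI impI)
    fix s assume s: "s \<in> T" "\<bar>s - t\<bar> < min p q"
    have "\<bar>(F ?j - F s - D * (?j - s)) - (G ?j - G s - E * (?j - s))\<bar>
        \<le> e / 2 * \<bar>?j - s\<bar> + e / 2 * \<bar>?j - s\<bar>"
      using p[of s] q[of s] s by (intro order_trans[OF abs_triangle_ineq4 add_mono]) simp_all
    then show "\<bar>(F ?j - G ?j) - (F s - G s) - (D - E) * (?j - s)\<bar> \<le> e * \<bar>?j - s\<bar>"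
      by (simp add: algebra_simps)
  qed (use \<open>p > 0\<close> \<open>q > 0\<close> in simp)
qed

lemma in_ts_kappaI: "t \<in> T \<Longrightarrow> s \<in> T \<Longrightarrow> t < s \<Longrightarrow> t \<in> ts_kappa T"
  by (force simp: ts_kappa_def)

lemma ts_kappa_subset: "ts_kappa T \<subseteq> T"
  by (auto simp: ts_kappa_def)

section \<open>Monotonicity and uniqueness of antiderivatives\<close>

text \<open>The argument must cope with countably many points without derivative. Tilting \<open>F\<close> to
  \<open>E t = F t + e * t\<close> makes the derivative positive wherever it exists. If \<open>E\<close> dropped from
  \<open>x\<close> to \<open>y\<close>, then some level \<open>v\<close> strictly between \<open>E y\<close> and \<open>E x\<close> would be missed by the
  countably many values of \<open>E\<close> at exceptional points. At the last point \<open>z\<close> with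
  \<open>v \<le> E z\<close>, either \<open>z\<close> is right-scattered and \<open>E\<close> does not decrease across the gap, or
  \<open>E z = v\<close> by continuity, so \<open>z\<close> is not exceptional and \<open>E\<close> increases just to the right of
  \<open>z\<close>. Both contradict that \<open>z\<close> is last.\<close>

lemma mono_on_of_delta_derivative_nonneg:
  assumes T: "closed T" and F: "delta_pre_antiderivative T f F"
    and f: "\<And>t. t \<in> T \<Longrightarrow> 0 \<le> f t"
  shows "mono_on T F"
proof (rule mono_onI)
  fix x y assume x: "x \<in> T" and y: "y \<in> T" and xy: "x \<le> y"
  obtain D where D: "D \<subseteq> ts_kappa T" and count: "countable (ts_kappa T - D)"
    and dense: "\<And>t. t \<in> ts_kappa T - D \<Longrightarrow> \<not> t < forward_jump T t"
    and der: "\<And>t. t \<in> D \<Longrightarrow> has_delta_derivative F (f t) T t"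
    and cont: "continuous_on T F"
    using F unfolding delta_pre_antiderivative_def by blast
  have "F x + e * x \<le> F y + e * y" if e: "e > 0" for e
  proof (rule ccontr)
    define E where "E t = F t + e * t" for t
    assume "\<not> F x + e * x \<le> F y + e * y"
    then have less: "E y < E x" by (simp add: E_def)
    \<comment> \<open>The level \<open>v\<close> is chosen so that no exceptional point lies on it.\<close>
    have "uncountable ({E y<..<E x} - E ` (ts_kappa T - D))"
      using less count by (intro uncountable_minus_countable uncountable_open_interval[THEN iffD2]) auto
    then obtain v where v: "E y < v" "v < E x" and gen: "v \<notin> E ` (ts_kappa T - D)"
      by (metis (no_types, lifting) DiffE countable_empty equals0I greaterThanLessThan_iff)
    have contE: "continuous_on T E"
      unfolding E_def by (intro continuous_intros cont)
    define U where "U = {t \<in> T \<inter> {x..y}. v \<le> E t}"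
    have "closed U"
      unfolding U_def using T
      by (intro continuous_on_closed_Collect_le continuous_on_subset[OF contE]) auto
    moreover have bdd: "bdd_above U"
      by (auto simp: U_def intro: bdd_aboveI[of _ y])
    moreover have "x \<in> U"
      using x xy v by (simp add: U_def)
    ultimately have "Sup U \<in> U"
      by (intro closed_contains_Sup) auto
    then obtain z where zU: "z \<in> U" and zmax: "\<And>t. t \<in> U \<Longrightarrow> t \<le> z"
      using cSup_upper[OF _ bdd] by blast
    have z: "z \<in> T" "x \<le> z" "z < y" "v \<le> E z"
      using zU v by (auto simp: U_def less_le)
    have kappa: "z \<in> ts_kappa T"
      using in_ts_kappaI[OF z(1) y z(3)] .
    let ?j = "forward_jump T z"
    note jump = forward_jump_between[OF T y z(3)]
    show False
    proof (cases "z < ?j")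
      case True
      then have "z \<in> D"
        using dense kappa by blast
      then have "F ?j - F z = f z * (?j - z)"
        using has_delta_derivative_jump[OF der z(1)] by blast
      moreover have "f z * (?j - z) \<ge> 0" "e * (?j - z) \<ge> 0"
        using f[OF z(1)] jump e by auto
      ultimately have "E z \<le> E ?j"
        by (simp add: E_def algebra_simps)
      then have "?j \<in> U"
        using z jump by (simp add: U_def)
      then show False
        using zmax True by fastforce
    next
      case False
      then have jz: "?j = z"
        using jump by simp
      have beyond: "E r < v" if "r \<in> T" "z < r" "r < y" for r
        using zmax[of r] that z by (force simp: U_def)
      have "E z = v"
      proof (rule ccontr)
        assume "E z \<noteq> v"
        then have "0 < E z - v" using z by simp
        then obtain p where p: "p > 0" "\<And>s. s \<in> T \<Longrightarrow> dist s z < p \<Longrightarrow> dist (E s) (E z) < E z - v"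
          using contE z(1) unfolding continuous_on_iff by metis
        obtain r where r: "r \<in> T" "z < r" "r < z + p" "r < y"
          using right_dense_approach[OF T jz y z(3) p(1)] by blast
        have "dist (E r) (E z) < E z - v"
          using p(2)[of r] r by (simp add: dist_real_def)
        then show False
          using beyond[of r] r unfolding dist_real_def by linarith
      qed
      then have "z \<in> D"
        using gen kappa by blast
      \<comment> \<open>Accuracy \<open>e\<close> is enough: an error of slope \<open>e\<close> is what the tilt by \<open>e\<close> absorbs.\<close>
      then obtain p where p: "p > 0"
        "\<And>s. s \<in> T \<Longrightarrow> \<bar>s - z\<bar> < p \<Longrightarrow> \<bar>F z - F s - f z * (z - s)\<bar> \<le> e * \<bar>z - s\<bar>"
        using der[of z] e jz unfolding has_delta_derivative_def by metis
      obtain r where r: "r \<in> T" "z < r" "r < z + p" "r < y"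
        using right_dense_approach[OF T jz y z(3) p(1)] by blast
      have "\<bar>F z - F r - f z * (z - r)\<bar> \<le> e * \<bar>z - r\<bar>"
        using p(2)[of r] r by simp
      moreover have "f z * (r - z) \<ge> 0"
        using f[OF z(1)] r by simp
      ultimately have "E z \<le> E r"
        using r unfolding E_def right_diff_distrib by (simp add: algebra_simps abs_le_iff)
      then show False
        using beyond[of r] r z by simp
    qed
  qed
  then have bound: "F x - F y \<le> e * (y - x)" if "e > 0" for e
    using that by (simp add: algebra_simps)
  have "F x - F y \<le> 0 + e" if "e > 0" for e
  proof -
    have "e / (y - x + 1) * (y - x) \<le> e"
      using that xy by (simp add: field_simps)
    with bound[of "e / (y - x + 1)"] that xy show ?thesis by simp
  qed
  from field_le_epsilon[OF this] show "F x \<le> F y" by simp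
qed

lemma delta_pre_antiderivative_diff:
  assumes "delta_pre_antiderivative T f F" "delta_pre_antiderivative T g G"
  shows "delta_pre_antiderivative T (\<lambda>t. f t - g t) (\<lambda>t. F t - G t)"
proof -
  obtain D where D: "D \<subseteq> ts_kappa T" "countable (ts_kappa T - D)"
    "\<forall>t \<in> ts_kappa T - D. \<not> t < forward_jump T t"
    "\<forall>t \<in> D. has_delta_derivative F (f t) T t" "continuous_on T F"
    using assms(1) unfolding delta_pre_antiderivative_def by blast
  obtain E where E: "E \<subseteq> ts_kappa T" "countable (ts_kappa T - E)"
    "\<forall>t \<in> ts_kappa T - E. \<not> t < forward_jump T t"
    "\<forall>t \<in> E. has_delta_derivative G (g t) T t" "continuous_on T G"
    using assms(2) unfolding delta_pre_antiderivative_def by blast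
  show ?thesis
    unfolding delta_pre_antiderivative_def
  proof (intro conjI exI[of _ "D \<inter> E"] ballI)
    show "countable (ts_kappa T - D \<inter> E)"
      using D(2) E(2) by (simp add: Diff_Int)
    show "continuous_on T (\<lambda>t. F t - G t)"
      using D(5) E(5) by (intro continuous_intros)
  qed (use D E in \<open>auto intro: has_delta_derivative_diff\<close>)
qed

lemma delta_pre_antiderivative_unique:
  assumes T: "closed T"
    and FG: "delta_pre_antiderivative T f F" "delta_pre_antiderivative T f G"
    and ab: "a \<in> T" "b \<in> T" "a \<le> b"
  shows "F b - F a = G b - G a"
proof -
  have "mono_on T (\<lambda>t. F t - G t)" "mono_on T (\<lambda>t. G t - F t)"
    using mono_on_of_delta_derivative_nonneg[OF T delta_pre_antiderivative_diff[OF FG]]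
      mono_on_of_delta_derivative_nonneg[OF T delta_pre_antiderivative_diff[OF FG(2,1)]]
    by simp_all
  from mono_onD[OF this(1) ab] mono_onD[OF this(2) ab] show ?thesis
    by simp
qed

section \<open>Stieltjes integration against an antiderivative\<close>

lemma compact_Inf_mem:
  fixes S :: "real set"
  assumes "compact S" "x \<in> S"
  shows "Inf S \<in> S" "Inf S \<le> x"
proof -
  have "S \<noteq> {}" using assms(2) by auto
  then show "Inf S \<in> S" "Inf S \<le> x"
    using assms by (simp_all add: closed_contains_Inf cInf_lower compact_imp_closed
      bounded_imp_bdd_below compact_imp_bounded)
qed

text \<open>The quantile function of the mass distribution \<open>F\<close> on \<open>S\<close>. Adding \<open>Inf S\<close> to the set
  makes the function total and monotone on the whole line, with values in \<open>S\<close> also for masses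
  below the range of \<open>F\<close>.\<close>

definition mass_quantile :: "real set \<Rightarrow> (real \<Rightarrow> real) \<Rightarrow> real \<Rightarrow> real" where
  "mass_quantile S F y = Sup (insert (Inf S) {x \<in> S. F x \<le> y})"

text \<open>The Stieltjes integral of \<open>k\<close> against \<open>F\<close> from the minimum of \<open>S\<close> to \<open>t\<close>.\<close>

definition integral_against :: "real set \<Rightarrow> (real \<Rightarrow> real) \<Rightarrow> (real \<Rightarrow> real) \<Rightarrow> real \<Rightarrow> real" where
  "integral_against S F k t = integral {F (Inf S)..F t} (\<lambda>y. k (mass_quantile S F y))"

context
  fixes S :: "real set" and F :: "real \<Rightarrow> real"
  assumes S: "compact S" "S \<noteq> {}" and F: "continuous_on S F" "mono_on S F"
begin

lemma Inf_in: "Inf S \<in> S"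
  using compact_Inf_mem(1) S by blast

lemma sublevel_bdd: "bdd_above (insert (Inf S) {x \<in> S. F x \<le> y})"
proof -
  have "bdd_above S"
    using S by (intro bounded_imp_bdd_above compact_imp_bounded)
  then show ?thesis by (auto intro: bdd_above_mono)
qed

lemma mass_quantile_mem: "mass_quantile S F y \<in> insert (Inf S) {x \<in> S. F x \<le> y}"
  unfolding mass_quantile_def
  using S(1) by (intro closed_contains_Sup sublevel_bdd closed_insert
      continuous_on_closed_Collect_le F continuous_intros compact_imp_closed) auto

lemma mass_quantile_in: "mass_quantile S F y \<in> S"
  using mass_quantile_mem[of y] Inf_in by auto

lemma mass_quantile_mono: "mono (mass_quantile S F)"
  unfolding mass_quantile_def
  by (intro monoI cSup_subset_mono sublevel_bdd) auto

text \<open>The right end \<open>t\<close> is excluded, so for a gap of \<open>S\<close> from \<open>x\<close> to \<open>t\<close> the quantile is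
  constantly \<open>x\<close>.\<close>

lemma mass_quantile_between:
  assumes "x \<in> S" "t \<in> S" "F x \<le> y" "y < F t"
  shows "mass_quantile S F y \<in> {x..<t} \<inter> S"
proof -
  have "x \<le> mass_quantile S F y"
    unfolding mass_quantile_def using assms by (intro cSup_upper sublevel_bdd) auto
  moreover have "F (Inf S) \<le> y"
    using mono_onD[OF F(2) Inf_in assms(1) compact_Inf_mem(2)[OF S(1) assms(1)]] assms(3) by simp
  then have "F (mass_quantile S F y) \<le> y"
    using mass_quantile_mem[of y] by auto
  then have "mass_quantile S F y < t"
    using mono_onD[OF F(2) assms(2) mass_quantile_in, of y] assms(4) by fastforce
  ultimately show ?thesis
    using mass_quantile_in by simp
qed

lemma integrable_mass_quantile:
  fixes k :: "real \<Rightarrow> real"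
  assumes "continuous_on S k"
  shows "(\<lambda>y. k (mass_quantile S F y)) integrable_on {p..q}"
proof -
  have "bounded (k ` S)"
    using assms S(1) by (intro compact_imp_bounded compact_continuous_image)
  then obtain B where B: "\<And>x. x \<in> S \<Longrightarrow> norm (k x) \<le> B"
    unfolding bounded_iff by auto
  have "(\<lambda>x. indicator S x *\<^sub>R k x) \<in> borel_measurable borel"
    using assms S(1) by (intro borel_measurable_continuous_on_indicator borel_compact)
  from measurable_compose[OF borel_measurable_mono[OF mass_quantile_mono] this]
  have "(\<lambda>y. k (mass_quantile S F y)) \<in> borel_measurable borel"
    by (simp add: mass_quantile_in)
  then have "set_integrable lborel {p..q} (\<lambda>y. k (mass_quantile S F y))"
    unfolding set_integrable_def
    by (intro integrableI_bounded_set_indicator[where B = B])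
      (use B[OF mass_quantile_in] in \<open>auto simp: emeasure_lborel_Icc_eq\<close>)
  from set_borel_integral_eq_integral(1)[OF this] show ?thesis .
qed

text \<open>This is the mean value estimate for the Stieltjes integral. Only the values of \<open>k\<close> on
  \<open>{x..<t}\<close> enter, because masses strictly below \<open>F t\<close> have their quantile there and the
  single mass \<open>F t\<close> does not affect the integral.\<close>

lemma integral_against_increment:
  assumes k: "continuous_on S k" and xt: "x \<in> S" "t \<in> S" "x \<le> t"
    and e: "0 \<le> e" and close: "\<And>r. r \<in> {x..<t} \<inter> S \<Longrightarrow> \<bar>k r - c\<bar> \<le> e"
  shows "\<bar>integral_against S F k t - integral_against S F k x - c * (F t - F x)\<bar> \<le> e * (F t - F x)"
proof -
  let ?r = "\<lambda>y. k (mass_quantile S F y)"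
  have le: "F (Inf S) \<le> F x" "F x \<le> F t"
    using mono_onD[OF F(2)] Inf_in compact_Inf_mem(2)[OF S(1)] xt by auto
  have int: "?r integrable_on {F x..F t}"
    using integrable_mass_quantile[OF k] .
  have eq: "integral_against S F k t - integral_against S F k x = integral {F x..F t} ?r"
    using Henstock_Kurzweil_Integration.integral_combine[OF le integrable_mass_quantile[OF k]]
    by (simp add: integral_against_def)
  have "((\<lambda>y. ?r y - c) has_integral (integral {F x..F t} ?r - c * (F t - F x))) {F x..F t}"
    using has_integral_diff[OF integrable_integral[OF int] has_integral_const_real[of c]] le
    by (simp add: mult.commute)
  then have "norm (integral {F x..F t} ?r - c * (F t - F x)) \<le> e * measure lborel (cbox (F x) (F t))"
    by (intro has_integral_bound_spike_finite[where S = "{F t}", OF e])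
      (use close mass_quantile_between[OF xt(1,2)] in auto)
  then show ?thesis
    using le by (simp add: eq)
qed

lemma continuous_on_integral_against:
  assumes "continuous_on S k"
  shows "continuous_on S (integral_against S F k)"
proof -
  have "continuous_on {F (Inf S)..F (Sup S)} (\<lambda>v. integral {F (Inf S)..v} (\<lambda>y. k (mass_quantile S F y)))"
    by (rule indefinite_integral_continuous_1[OF integrable_mass_quantile[OF assms]])
  moreover have "Sup S \<in> S" "\<And>x. x \<in> S \<Longrightarrow> x \<le> Sup S"
    using S by (simp_all add: closed_contains_Sup cSup_upper compact_imp_closed
      bounded_imp_bdd_above compact_imp_bounded)
  then have "F ` S \<subseteq> {F (Inf S)..F (Sup S)}"
    using mono_onD[OF F(2)] Inf_in compact_Inf_mem(2)[OF S(1)] by auto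
  ultimately show ?thesis
    unfolding integral_against_def by (rule continuous_on_compose2[OF _ F(1)])
qed

text \<open>By the mean value estimate, the increment of the integral from \<open>s\<close> to the forward jump
  of \<open>t\<close> is close to \<open>k t\<close> times that of \<open>F\<close>, since every point of \<open>S\<close> in between, left end
  included and right end excluded, is close to \<open>t\<close>. This holds whether or not \<open>t\<close> is
  right-scattered, since no point of \<open>S\<close> lies strictly between \<open>t\<close> and its forward jump.\<close>

lemma has_delta_derivative_integral_against:
  assumes k: "continuous_on S k" and t: "t \<in> S" and der: "has_delta_derivative F D S t"
  shows "has_delta_derivative (integral_against S F k) (k t * D) S t"
  unfolding has_delta_derivative_def
proof (intro allI impI)
  fix e :: real assume e: "e > 0"
  let ?G = "integral_against S F k" and ?j = "forward_jump S t"
  have cl: "closed S" using S by (simp add: compact_imp_closed)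
  have j: "?j \<in> S" "t \<le> ?j"
    using forward_jump_in[OF cl t] forward_jump_ge[OF cl] by auto
  \<comment> \<open>\<open>e1\<close> bounds the variation of \<open>k\<close>, which gets multiplied by a slope of \<open>F\<close> of at most
     \<open>\<bar>D\<bar> + 1\<close>; \<open>e2\<close> bounds the error in the derivative of \<open>F\<close>, which gets multiplied by \<open>k t\<close>.
     Each contributes half of \<open>e\<close>.\<close>
  define e1 where "e1 = e / 2 / (\<bar>D\<bar> + 1)"
  define e2 where "e2 = min 1 (e / 2 / (\<bar>k t\<bar> + 1))"
  have e1: "e1 > 0" "e1 * (\<bar>D\<bar> + 1) = e / 2" and e2: "e2 > 0" "e2 \<le> 1" "\<bar>k t\<bar> * e2 \<le> e / 2"
  proof -
    have "\<bar>k t\<bar> * e2 \<le> \<bar>k t\<bar> * (e / 2 / (\<bar>k t\<bar> + 1))"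
      unfolding e2_def by (intro mult_left_mono) auto
    also have "\<dots> \<le> e / 2"
      using e by (simp add: field_simps)
    finally show "\<bar>k t\<bar> * e2 \<le> e / 2" .
    have "\<bar>D\<bar> + 1 \<noteq> 0" by linarith
    then show "e1 * (\<bar>D\<bar> + 1) = e / 2"
      by (metis e1_def nonzero_divide_eq_eq)
  qed (use e in \<open>auto simp: e1_def e2_def\<close>)
  obtain p where p: "p > 0" "\<And>r. r \<in> S \<Longrightarrow> dist r t < p \<Longrightarrow> dist (k r) (k t) < e1"
    using k t e1(1) unfolding continuous_on_iff by metis
  obtain q where q: "q > 0"
    "\<And>s. s \<in> S \<Longrightarrow> \<bar>s - t\<bar> < q \<Longrightarrow> \<bar>F ?j - F s - D * (?j - s)\<bar> \<le> e2 * \<bar>?j - s\<bar>"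
    using der e2(1) unfolding has_delta_derivative_def by metis
  show "\<exists>d>0. \<forall>s\<in>S. \<bar>s - t\<bar> < d \<longrightarrow>
    \<bar>?G ?j - ?G s - k t * D * (?j - s)\<bar> \<le> e * \<bar>?j - s\<bar>"
  proof (intro exI[of _ "min p q"] conjI ballI impI)
    fix s assume s: "s \<in> S" "\<bar>s - t\<bar> < min p q"
    have near: "\<bar>k r - k t\<bar> \<le> e1" if "r \<in> S" "min s ?j \<le> r" "r < max s ?j" for r
    proof -
      have "r \<le> t" if "r < ?j"
        using forward_jump_between(3)[OF cl \<open>r \<in> S\<close>, of t] that by force
      then have "dist r t < p"
        using s(2) that(2,3) j(2) by (cases "s \<le> ?j"; cases "r < ?j") (auto simp: dist_real_def)
      then show ?thesis
        using p(2)[OF \<open>r \<in> S\<close>] by (simp add: dist_real_def)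
    qed
    have G: "\<bar>?G ?j - ?G s - k t * (F ?j - F s)\<bar> \<le> e1 * \<bar>F ?j - F s\<bar>"
    proof (cases "s \<le> ?j")
      case True
      then have "\<bar>?G ?j - ?G s - k t * (F ?j - F s)\<bar> \<le> e1 * (F ?j - F s)"
        by (intro integral_against_increment[OF k s(1) j(1)] near) (use e1 in auto)
      also have "\<dots> \<le> e1 * \<bar>F ?j - F s\<bar>"
        using e1 by (intro mult_left_mono) auto
      finally show ?thesis .
    next
      case False
      then have "\<bar>?G s - ?G ?j - k t * (F s - F ?j)\<bar> \<le> e1 * (F s - F ?j)"
        by (intro integral_against_increment[OF k j(1) s(1)] near) (use e1 in auto)
      also have "\<dots> \<le> e1 * \<bar>F s - F ?j\<bar>"
        using e1 by (intro mult_left_mono) auto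
      finally show ?thesis
        unfolding right_diff_distrib by (simp add: abs_minus_commute)
    qed
    have Fq: "\<bar>F ?j - F s - D * (?j - s)\<bar> \<le> e2 * \<bar>?j - s\<bar>"
      using q(2)[OF s(1)] s(2) by simp
    have "\<bar>F ?j - F s\<bar> \<le> \<bar>D * (?j - s)\<bar> + e2 * \<bar>?j - s\<bar>"
      using Fq by linarith
    also have "\<dots> \<le> (\<bar>D\<bar> + 1) * \<bar>?j - s\<bar>"
      using mult_right_mono[OF e2(2), of "\<bar>?j - s\<bar>"] by (simp add: abs_mult distrib_right)
    finally have "e1 * \<bar>F ?j - F s\<bar> \<le> e1 * ((\<bar>D\<bar> + 1) * \<bar>?j - s\<bar>)"
      using e1 by (intro mult_left_mono) auto
    also have "\<dots> = e / 2 * \<bar>?j - s\<bar>"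
      using e1(2) by (metis mult.assoc)
    finally have first: "\<bar>?G ?j - ?G s - k t * (F ?j - F s)\<bar> \<le> e / 2 * \<bar>?j - s\<bar>"
      using G by linarith
    have "\<bar>k t * (F ?j - F s - D * (?j - s))\<bar> \<le> \<bar>k t\<bar> * (e2 * \<bar>?j - s\<bar>)"
      unfolding abs_mult by (intro mult_left_mono Fq) auto
    also have "\<dots> \<le> e / 2 * \<bar>?j - s\<bar>"
      using mult_right_mono[OF e2(3), of "\<bar>?j - s\<bar>"] by (simp add: mult.assoc)
    finally have second: "\<bar>k t * (F ?j - F s - D * (?j - s))\<bar> \<le> e / 2 * \<bar>?j - s\<bar>" .
    have "?G ?j - ?G s - k t * D * (?j - s)
        = (?G ?j - ?G s - k t * (F ?j - F s)) + k t * (F ?j - F s - D * (?j - s))"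
      by (simp add: algebra_simps)
    then show "\<bar>?G ?j - ?G s - k t * D * (?j - s)\<bar> \<le> e * \<bar>?j - s\<bar>"
      using first second by linarith
  qed (use p(1) q(1) in simp)
qed

lemma delta_pre_antiderivative_integral_against:
  assumes k: "continuous_on S k" and u: "delta_pre_antiderivative S u F"
  shows "delta_pre_antiderivative S (\<lambda>t. k t * u t) (integral_against S F k)"
  using u has_delta_derivative_integral_against[OF k] continuous_on_integral_against[OF k] ts_kappa_subset[of S]
  unfolding delta_pre_antiderivative_def by (meson subset_iff)

end

section \<open>Fractional integrals as integrals over mass\<close>

lemma frac_weight_nonneg: "0 \<le> frac_weight \<alpha> t"
  by (simp add: frac_weight_def)

lemma frac_integral_eq:
  assumes "closed S" "a \<in> S" "b \<in> S" "a \<le> b"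
    and F: "delta_pre_antiderivative S (\<lambda>t. f t * frac_weight \<alpha> t) F"
  shows "frac_integral S \<alpha> a b f = F b - F a"
proof -
  have "delta_pre_antiderivative S (\<lambda>t. f t * frac_weight \<alpha> t) (indefinite_frac_integral S \<alpha> f)"
    
    unfolding indefinite_frac_integral_def indefinite_delta_integral_def
    by (rule someI[where P = "delta_pre_antiderivative S (\<lambda>t. f t * frac_weight \<alpha> t)", OF F])
  from delta_pre_antiderivative_unique[OF assms(1) this F assms(2-4)] F show ?thesis
    by (auto simp: frac_integral_def frac_integrable_def delta_integrable_def)
qed

text \<open>The left-hand side is a difference of values of an arbitrarily chosen antiderivative;
  uniqueness allows it to be computed with the Stieltjes integral.\<close>

lemma frac_integral_eq_quantile_integral:
  assumes S: "compact S" "S \<noteq> {}"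
    and v: "\<And>t. t \<in> S \<Longrightarrow> 0 \<le> v t"
    and F: "delta_pre_antiderivative S (\<lambda>t. v t * frac_weight \<alpha> t) F"
    and k: "continuous_on S k"
    and b: "b \<in> S"
  shows "frac_integral S \<alpha> (Inf S) b (\<lambda>s. k s * v s)
    = integral {F (Inf S)..F b} (\<lambda>y. k (mass_quantile S F y))"
proof -
  have cl: "closed S"
    using S by (simp add: compact_imp_closed)
  have F': "continuous_on S F" "mono_on S F"
    using F mono_on_of_delta_derivative_nonneg[OF cl F] v
    by (auto simp: delta_pre_antiderivative_def frac_weight_nonneg)
  have "delta_pre_antiderivative S (\<lambda>t. k t * v t * frac_weight \<alpha> t) (integral_against S F k)"
    using delta_pre_antiderivative_integral_against[OF S F' k F] by (simp add: mult.assoc)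
  from frac_integral_eq[OF cl compact_Inf_mem(1)[OF S(1) b] b compact_Inf_mem(2)[OF S(1) b] this] show ?thesis
    by (simp add: integral_against_def)
qed

section \<open>Jensen's inequality\<close>

text \<open>A supporting line of \<open>f\<close> at the mean \<open>m\<close> of \<open>r\<close> lies below \<open>f\<close> and has mean \<open>f m\<close> along
  \<open>r\<close>. The compact set \<open>K\<close> keeps \<open>m\<close> away from the ends of \<open>{c<..<d}\<close>, where there need not
  be such a line.\<close>

lemma jensen_integral:
  fixes r f :: "real \<Rightarrow> real"
  assumes f: "convex_on {c<..<d} f" and pq: "p < q"
    and K: "compact K" "K \<subseteq> {c<..<d}" and rK: "\<And>y. r y \<in> K"
    and int: "r integrable_on {p..q}" "(\<lambda>y. f (r y)) integrable_on {p..q}"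
  shows "f (integral {p..q} r / (q - p)) \<le> integral {p..q} (\<lambda>y. f (r y)) / (q - p)"
proof -
  define m where "m = integral {p..q} r / (q - p)"
  have "K \<noteq> {}" using rK by auto
  then obtain lo hi where K': "lo \<in> K" "hi \<in> K" "\<And>x. x \<in> K \<Longrightarrow> lo \<le> x \<and> x \<le> hi"
    using compact_attains_inf[OF K(1)] compact_attains_sup[OF K(1)] by metis
  have "integral {p..q} (\<lambda>_. lo) \<le> integral {p..q} r" "integral {p..q} r \<le> integral {p..q} (\<lambda>_. hi)"
    using K'(3) rK by (intro integral_le int integrable_const_ivl; simp)+
  then have "lo \<le> m" "m \<le> hi"
    using pq by (auto simp: m_def field_simps)
  then have m: "m \<in> {c<..<d}"
    using K(2) K'(1,2) by fastforce
  obtain l where l: "\<And>y. y \<in> {c<..<d} \<Longrightarrow> f m + l * (y - m) \<le> f y"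
    using convex_le_Inf_differential[OF f] m by auto
  have intr: "(\<lambda>y. f m + l * (r y - m)) integrable_on {p..q}"
    using integrable_on_cmult_left[OF integrable_diff[OF int(1) integrable_const_ivl]]
    by (intro integrable_add integrable_const_ivl) simp
  have "integral {p..q} (\<lambda>y. f m + l * (r y - m)) = (q - p) * f m + l * (integral {p..q} r - (q - p) * m)"
  proof -
    have const: "((\<lambda>_. z) has_integral (q - p) * z) {p..q}" for z
      using has_integral_const_real[of z p q] pq by simp
    have "((\<lambda>y. f m + l * (r y - m)) has_integral (q - p) * f m + l * (integral {p..q} r - (q - p) * m)) {p..q}"
      by (intro has_integral_add has_integral_mult_right has_integral_diff integrable_integral int const)
    then show ?thesis by (rule integral_unique)
  qed
  also have "\<dots> = (q - p) * f m"
    using pq by (simp add: m_def)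
  finally have "(q - p) * f m = integral {p..q} (\<lambda>y. f m + l * (r y - m))" ..
  also have "\<dots> \<le> integral {p..q} (\<lambda>y. f (r y))"
    using l K(2) rK by (intro integral_le intr int) blast
  finally show ?thesis
    using pq by (simp add: m_def[symmetric] field_simps)
qed

theorem theorem11:
  fixes T :: "real set" and a b c d \<alpha> :: real and g h :: "real \<Rightarrow> real"
  assumes "time_scale T" and "a \<in> T" and "b \<in> T" and "a < b"
    and "0 < \<alpha>" and "\<alpha> \<le> 1"
    and "continuous_on ({a..b} \<inter> T) g" and "g ` ({a..b} \<inter> T) \<subseteq> {c<..<d}"
    and "continuous_on ({a..b} \<inter> T) h"
    and "frac_integral ({a..b} \<inter> T) \<alpha> a b (\<lambda>s. \<bar>h s\<bar>) > 0"
  shows "(\<forall>f :: real \<Rightarrow> real. continuous_on {c<..<d} f \<and> convex_on {c<..<d} f \<longrightarrow>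
            f (frac_integral ({a..b} \<inter> T) \<alpha> a b (\<lambda>s. g s * \<bar>h s\<bar>)
               / frac_integral ({a..b} \<inter> T) \<alpha> a b (\<lambda>s. \<bar>h s\<bar>))
            \<le> frac_integral ({a..b} \<inter> T) \<alpha> a b (\<lambda>s. f (g s) * \<bar>h s\<bar>)
               / frac_integral ({a..b} \<inter> T) \<alpha> a b (\<lambda>s. \<bar>h s\<bar>))
       \<and> (\<forall>f :: real \<Rightarrow> real. continuous_on {c<..<d} f \<and> concave_on {c<..<d} f \<longrightarrow>
            f (frac_integral ({a..b} \<inter> T) \<alpha> a b (\<lambda>s. g s * \<bar>h s\<bar>)
               / frac_integral ({a..b} \<inter> T) \<alpha> a b (\<lambda>s. \<bar>h s\<bar>))
            \<ge> frac_integral ({a..b} \<inter> T) \<alpha> a b (\<lambda>s. f (g s) * \<bar>h s\<bar>)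
               / frac_integral ({a..b} \<inter> T) \<alpha> a b (\<lambda>s. \<bar>h s\<bar>))"
proof -
  define S where "S = {a..b} \<inter> T"
  note g = \<open>continuous_on ({a..b} \<inter> T) g\<close>[folded S_def]
    and img = \<open>g ` ({a..b} \<inter> T) \<subseteq> {c<..<d}\<close>[folded S_def]
    and pos = \<open>frac_integral ({a..b} \<inter> T) \<alpha> a b (\<lambda>s. \<bar>h s\<bar>) > 0\<close>[folded S_def]
  have S: "compact S"
    using \<open>time_scale T\<close> by (auto simp: S_def time_scale_def intro: compact_Int_closed)
  have mem: "a \<in> S" "b \<in> S" "S \<noteq> {}"
    using \<open>a \<in> T\<close> \<open>b \<in> T\<close> \<open>a < b\<close> unfolding S_def by force+
  have a: "a = Inf S"
    using mem by (intro cInf_eq_minimum[symmetric]) (auto simp: S_def)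
  obtain F where F: "delta_pre_antiderivative S (\<lambda>t. \<bar>h t\<bar> * frac_weight \<alpha> t) F"
    using pos by (auto simp: frac_integral_def frac_integrable_def delta_integrable_def split: if_splits)
  have F': "continuous_on S F" "mono_on S F"
    using F mono_on_of_delta_derivative_nonneg[OF compact_imp_closed[OF S] F]
    by (auto simp: delta_pre_antiderivative_def frac_weight_nonneg)
  have mass: "frac_integral S \<alpha> a b (\<lambda>s. \<bar>h s\<bar>) = F b - F a"
    using mem \<open>a < b\<close> by (intro frac_integral_eq[OF _ _ _ _ F] compact_imp_closed S) auto
  have quantile: "frac_integral S \<alpha> a b (\<lambda>s. k s * \<bar>h s\<bar>) = integral {F a..F b} (\<lambda>y. k (mass_quantile S F y))"
    if "continuous_on S k" for k
    using frac_integral_eq_quantile_integral[OF S mem(3) _ F that mem(2)] a by simp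
  have convex: "f (frac_integral S \<alpha> a b (\<lambda>s. g s * \<bar>h s\<bar>) / frac_integral S \<alpha> a b (\<lambda>s. \<bar>h s\<bar>))
      \<le> frac_integral S \<alpha> a b (\<lambda>s. f (g s) * \<bar>h s\<bar>) / frac_integral S \<alpha> a b (\<lambda>s. \<bar>h s\<bar>)"
    if f: "continuous_on {c<..<d} f" "convex_on {c<..<d} f" for f
  proof -
    have fg: "continuous_on S (\<lambda>s. f (g s))"
      using continuous_on_compose2[OF f(1) g] img by blast
    show ?thesis
      unfolding quantile[OF g] quantile[OF fg] mass
      by (rule jensen_integral[OF f(2) _ compact_continuous_image[OF g S] img])
        (use pos mass in \<open>auto intro: mass_quantile_in[OF S mem(3) F']
          integrable_mass_quantile[OF S mem(3) F'] g fg\<close>)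
  qed
  have concave: "f (frac_integral S \<alpha> a b (\<lambda>s. g s * \<bar>h s\<bar>) / frac_integral S \<alpha> a b (\<lambda>s. \<bar>h s\<bar>))
      \<ge> frac_integral S \<alpha> a b (\<lambda>s. f (g s) * \<bar>h s\<bar>) / frac_integral S \<alpha> a b (\<lambda>s. \<bar>h s\<bar>)"
    if f: "continuous_on {c<..<d} f" "concave_on {c<..<d} f" for f
  proof -
    have fg: "continuous_on S (\<lambda>s. f (g s))" "continuous_on S (\<lambda>s. - f (g s))"
      using continuous_on_compose2[OF f(1) g] img by (auto intro: continuous_on_minus)
    have "frac_integral S \<alpha> a b (\<lambda>s. - f (g s) * \<bar>h s\<bar>) = - frac_integral S \<alpha> a b (\<lambda>s. f (g s) * \<bar>h s\<bar>)"
      unfolding quantile[OF fg(1)] quantile[OF fg(2)] by simp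
    then show ?thesis
      using convex[of "\<lambda>x. - f x"] f by (simp add: concave_on_def continuous_on_minus)
  qed
  show ?thesis
    using convex concave unfolding S_def by blast
qed

end
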